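(* Let $\mathcal F$ and $\mathcal G$ be two foliations in $(\mathbb C^2,0)$ and let $\mathcal J_{\mathcal F,\mathcal G}$ be their jacobian curve. Let $\pi_1:X_1\to(\mathbb C^2,0)$ be the blow-up of the origin and $E^1=\pi_1^{-1}(0)$ the exceptional divisor. If there is a point $R\in E^1$ such that the Camacho-Sad indices satisfy $\mathcal I_R(\pi_1^*\mathcal F,E^1)\ne\mathcal I_R(\pi_1^*\mathcal G,E^1)$, then $$\nu_0(\mathcal J_{\mathcal F,\mathcal G})=\nu_0(\mathcal F)+\nu_0(\mathcal G).$$
   Context: A foliation $\mathcal F$ in $(\mathbb C^2,0)$ is given by a $1$-form $\omega=A\,dx+B\,dy$ with $A,B\in\mathbb C\{x,y\}$ relatively prime; $\nu_0(\mathcal F)=\min\{\nu_0(A),\nu_0(B)\}$. $\pi_1^*\mathcal F$ is the strict transform. If $\mathcal G$ is given by $\eta=P\,dx+Q\,dy$, the jacobian curve $\mathcal J_{\mathcal F,\mathcal G}$ is the curve $\omega\wedge\eta=0$, i.e. $AQ-BP=0$, and $\nu_0(\mathcal J_{\mathcal F,\mathcal G})$ is the order at $0$ of $AQ-BP$. If a non-singular curve $S=(y=0)$ is invariant by a foliation given by $y\,a(x,y)\,dx+b(x,y)\,dy=0$, the Camacho-Sad index at the origin is $\mathcal I_0(\mathcal F,S)=-\mathrm{Res}_{x=0}\,a(x,0)/b(x,0)$ (it is $0$ at non-singular points); at other points it is defined in the same way using local coordinates. The indices in the statement are defined when $E^1$ is invariant by both $\pi_1^*\mathcal F$ and $\pi_1^*\mathcal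 G$, which is implicit in the hypothesis. *)

theory Defs
  imports "HOL-Complex_Analysis.Complex_Analysis"
begin

text \<open>
  A double power series \<open>\<Sum>\<^sub>i\<^sub>,\<^sub>j a\<^sub>i\<^sub>j x\<^sup>i y\<^sup>j\<close> is an element of \<open>\<complex>[[x]][[y]]\<close>: the outer variable is \<open>y\<close>,
  and \<open>a\<^sub>i\<^sub>j\<close> is \<open>A $ j $ i\<close>.
\<close>

type_synonym series2 = "complex fps fps"

definition varx :: series2 where "varx = fps_const fps_X"
definition vary :: series2 where "vary = fps_X"
definition const2 :: "complex \<Rightarrow> series2" where "const2 c = fps_const (fps_const c)"

text \<open>The ring \<open>\<complex>{x,y}\<close>.\<close>

definition conv2 :: "series2 set" where
  "conv2 = {A. \<exists>r>0. (\<lambda>(i, j). norm (A $ j $ i) * r ^ (i + j)) summable_on UNIV}"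

definition dvd2 :: "series2 \<Rightarrow> series2 \<Rightarrow> bool" where
  "dvd2 D A \<longleftrightarrow> (\<exists>U\<in>conv2. A = D * U)"

definition coprime2 :: "series2 \<Rightarrow> series2 \<Rightarrow> bool" where
  "coprime2 A B \<longleftrightarrow> (\<forall>D\<in>conv2. dvd2 D A \<longrightarrow> dvd2 D B \<longrightarrow> dvd2 D 1)"

text \<open>The order at the origin; the infimum over the empty set gives \<open>\<infinity>\<close> for the zero series.\<close>

definition order2 :: "series2 \<Rightarrow> enat" where
  "order2 A = Inf {enat (i + j) | i j. A $ j $ i \<noteq> 0}"

definition deriv_x :: "series2 \<Rightarrow> series2" where
  "deriv_x A = Abs_fps (\<lambda>j. fps_deriv (A $ j))"

definition deriv_y :: "series2 \<Rightarrow> series2" where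
  "deriv_y A = fps_deriv A"

text \<open>
  The substitution \<open>A(U, V)\<close>, for \<open>U\<close> and \<open>V\<close> without constant term. Then \<open>U\<^sup>i V\<^sup>j\<close> has order at least
  \<open>i + j\<close>, so the finite sum collects every contribution to the coefficient of \<open>x\<^sup>m y\<^sup>n\<close>.
\<close>

definition subst2 :: "series2 \<Rightarrow> series2 \<Rightarrow> series2 \<Rightarrow> series2" where
  "subst2 A U V = Abs_fps (\<lambda>n. Abs_fps (\<lambda>m.
     \<Sum>(i, j) \<in> {(i, j). i + j \<le> m + n}. A $ j $ i * (U ^ i * V ^ j) $ n $ m))"


text \<open>The pair \<open>(A, B)\<close> stands for the 1-form \<open>A dx + B dy\<close>.\<close>

type_synonym one_form = "series2 \<times> series2"

definition foliation :: "one_form \<Rightarrow> bool" where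
  "foliation \<omega> \<longleftrightarrow> fst \<omega> \<in> conv2 \<and> snd \<omega> \<in> conv2 \<and> coprime2 (fst \<omega>) (snd \<omega>)"

definition fol_order :: "one_form \<Rightarrow> enat" where
  "fol_order \<omega> = min (order2 (fst \<omega>)) (order2 (snd \<omega>))"

definition jacobian_curve :: "one_form \<Rightarrow> one_form \<Rightarrow> series2" where
  "jacobian_curve \<omega> \<eta> = fst \<omega> * snd \<eta> - snd \<omega> * fst \<eta>"

definition pullback :: "series2 \<times> series2 \<Rightarrow> one_form \<Rightarrow> one_form" where
  "pullback \<phi> \<omega> =
     (let U = fst \<phi>; V = snd \<phi>; A = subst2 (fst \<omega>) U V; B = subst2 (snd \<omega>) U V
      in (A * deriv_x U + B * deriv_x V, A * deriv_y U + B * deriv_y V))"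

text \<open>Division of a 1-form by the highest power of \<open>y\<close> dividing both coefficients.\<close>

definition divide_out_y :: "one_form \<Rightarrow> one_form" where
  "divide_out_y \<omega> =
     (let k = (LEAST k. fst \<omega> $ k \<noteq> 0 \<or> snd \<omega> $ k \<noteq> 0)
      in (fps_shift k (fst \<omega>), fps_shift k (snd \<omega>)))"

text \<open>The curve \<open>y = 0\<close> is invariant if the 1-form is \<open>y a dx + b dy\<close>.\<close>

definition y0_invariant :: "one_form \<Rightarrow> bool" where
  "y0_invariant \<omega> \<longleftrightarrow> dvd2 vary (fst \<omega>)"

text \<open>The index of \<open>y a dx + b dy\<close> along \<open>y = 0\<close>; the series \<open>F $ 0\<close> is the restriction \<open>F(x, 0)\<close>.\<close>

definition camacho_sad :: "one_form \<Rightarrow> complex" where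
  "camacho_sad \<omega> =
     (let a = fps_shift 1 (fst \<omega>); b = snd \<omega>
      in - residue (\<lambda>x. eval_fps (a $ 0) x / eval_fps (b $ 0) x) 0)"


definition line :: "complex \<times> complex \<Rightarrow> (complex \<times> complex) set" where
  "line v = range (\<lambda>c. (c * fst v, c * snd v))"

text \<open>The blow-up of the origin: pairs of a point and a line through the origin containing it.\<close>

definition blowup :: "((complex \<times> complex) \<times> (complex \<times> complex) set) set" where
  "blowup = {(p, L). (\<exists>v. v \<noteq> (0, 0) \<and> L = line v) \<and> p \<in> L}"

definition exc_divisor :: "((complex \<times> complex) \<times> (complex \<times> complex) set) set" where
  "exc_divisor = {R \<in> blowup. fst R = (0, 0)}"

text \<open>
  The blow-down map in local coordinates \<open>(x, y)\<close> of the blow-up centred at a point \<open>R\<close> of the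
  exceptional divisor. If the line of \<open>R\<close> is spanned by \<open>(1, t)\<close>, the coordinates parametrise the
  blow-up by \<open>((y, y (t + x)), line (1, t + x))\<close>; if it is spanned by \<open>(0, 1)\<close>, by
  \<open>((y x, y), line (x, 1))\<close>. In both cases the exceptional divisor is \<open>y = 0\<close>.
\<close>

definition blowdown_at ::
  "(complex \<times> complex) \<times> (complex \<times> complex) set \<Rightarrow> series2 \<times> series2" where
  "blowdown_at R =
     (if \<exists>t. snd R = line (1, t)
      then (let t = (THE t. snd R = line (1, t)) in (vary, vary * (const2 t + varx)))
      else (vary * varx, vary))"

text \<open>The strict transform of a foliation near \<open>R\<close>, in the above coordinates.\<close>

definition strict_transform ::
  "one_form \<Rightarrow> (complex \<times> complex) \<times> (complex \<times> complex) set \<Rightarrow> one_form" where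
  "strict_transform \<omega> R = divide_out_y (pullback (blowdown_at R) \<omega>)"

definition exc_invariant :: "one_form \<Rightarrow> bool" where
  "exc_invariant \<omega> \<longleftrightarrow> (\<forall>R\<in>exc_divisor. y0_invariant (strict_transform \<omega> R))"

definition exc_index ::
  "one_form \<Rightarrow> (complex \<times> complex) \<times> (complex \<times> complex) set \<Rightarrow> complex" where
  "exc_index \<omega> R = camacho_sad (strict_transform \<omega> R)"

end

theory Submission
  imports Defs
begin

unbundle no vec_syntax

text \<open>
  In either chart the blow-down map is \<open>(y p(x), y q(x))\<close> with \<open>p q' - p' q = \<plusminus>1\<close>. Write \<open>\<nu>\<close> for the
  order of \<open>\<omega> = A dx + B dy\<close> and \<open>A\<^sub>\<nu>\<close>, \<open>B\<^sub>\<nu>\<close> for the homogeneous parts of degree \<open>\<nu>\<close>. If the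
  exceptional divisor is invariant, the restriction to \<open>y = 0\<close> of the strict transform \<open>y a dx + b dy\<close>
  is \<open>a = A\<^sub>\<nu>(p,q) p' + B\<^sub>\<nu>(p,q) q'\<close>, \<open>b = A\<^sub>\<nu>(p,q) p + B\<^sub>\<nu>(p,q) q \<noteq> 0\<close>, and the index is \<open>- Res (a/b)\<close>.
  For two foliations, \<open>a\<^sub>1 b\<^sub>2 - a\<^sub>2 b\<^sub>1\<close> is \<open>\<plusminus>J(p,q)\<close>, where \<open>J\<close> is the homogeneous part of degree
  \<open>\<nu>\<^sub>1 + \<nu>\<^sub>2\<close> of the jacobian. If the order of the jacobian exceeds \<open>\<nu>\<^sub>1 + \<nu>\<^sub>2\<close>, then \<open>J = 0\<close>, so
  \<open>a\<^sub>1/b\<^sub>1 = a\<^sub>2/b\<^sub>2\<close> and all indices agree.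
\<close>

section \<open>Orders and homogeneous parts of double power series\<close>

lemma enat_le_order2_iff: "enat n \<le> order2 A \<longleftrightarrow> (\<forall>i j. i + j < n \<longrightarrow> A $ j $ i = 0)"
proof -
  have "enat n \<le> order2 A \<longleftrightarrow> (\<forall>i j. A $ j $ i \<noteq> 0 \<longrightarrow> n \<le> i + j)"
    unfolding order2_def le_Inf_iff by fastforce
  then show ?thesis
    by (metis not_le)
qed

lemma order2_le: "A $ j $ i \<noteq> 0 \<Longrightarrow> order2 A \<le> enat (i + j)"
  unfolding order2_def by (rule Inf_lower) auto

lemma order2_eq_enatD:
  assumes "order2 A = enat n"
  obtains j where "j \<le> n" "A $ j $ (n - j) \<noteq> 0"
proof -
  have "\<not> enat (Suc n) \<le> order2 A"
    using assms by simp
  then obtain i j where ij: "i + j < Suc n" "A $ j $ i \<noteq> 0"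
    unfolding enat_le_order2_iff by blast
  have "enat n \<le> order2 A" using assms by simp
  with ij have "i + j = n"
    unfolding enat_le_order2_iff by (metis less_SucE)
  with ij that[of j] show thesis by auto
qed

lemma order2_eq_infinity_iff: "order2 A = \<infinity> \<longleftrightarrow> A = 0"
proof
  assume "order2 A = \<infinity>"
  then have "A $ j $ i = 0" for i j
    using order2_le[of A j i] by auto
  then show "A = 0" by (simp add: fps_eq_iff)
qed (simp add: order2_def top_enat_def)

text \<open>This is the homogeneous form of degree \<open>n\<close> in \<open>A\<close>, evaluated
  at \<open>x = p\<close>, \<open>y = q\<close>; \<open>j\<close> is the exponent of
  \<open>y\<close>.\<close>

definition hom_part :: "nat \<Rightarrow> series2 \<Rightarrow> complex poly \<Rightarrow> complex poly \<Rightarrow> complex poly" where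
  "hom_part n A p q = (\<Sum>j\<le>n. smult (A $ j $ (n - j)) (p ^ (n - j) * q ^ j))"

lemma hom_part_diff: "hom_part n (A - B) p q = hom_part n A p q - hom_part n B p q"
  by (simp add: hom_part_def smult_diff_left sum_subtractf)

lemma hom_part_eq_0_if_less_order2: "enat n < order2 A \<Longrightarrow> hom_part n A p q = 0"
proof -
  assume "enat n < order2 A"
  then have "A $ j $ (n - j) = 0" if "j \<le> n" for j
    using order2_le[of A j "n - j"] that by (metis le_add_diff_inverse2 not_le)
  then show ?thesis by (simp add: hom_part_def)
qed

text \<open>The degrees \<open>n\<close> and \<open>m\<close> must be met exactly: a smaller degree
  in the first factor makes that factor vanish, a larger one makes the second vanish. So for each
  \<open>b\<close> at most the term with \<open>a = n - b\<close> survives.\<close>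

lemma nth_mult_lowest:
  assumes A: "enat n \<le> order2 A" and B: "enat m \<le> order2 B" and j: "j \<le> n + m"
  shows "(A * B) $ j $ (n + m - j) =
    (\<Sum>b\<in>{b. b \<le> j \<and> b \<le> n \<and> j - b \<le> m}. A $ b $ (n - b) * B $ (j - b) $ (m - (j - b)))"
proof -
  have A0: "A $ b $ a = 0" if "a + b < n" for a b
    using A that unfolding enat_le_order2_iff by blast
  have B0: "B $ b $ a = 0" if "a + b < m" for a b
    using B that unfolding enat_le_order2_iff by blast
  have inner: "(\<Sum>a\<le>n+m-j. A $ b $ a * B $ (j - b) $ (n + m - j - a)) =
      (if b \<le> n \<and> j - b \<le> m then A $ b $ (n - b) * B $ (j - b) $ (m - (j - b)) else 0)"
    if b: "b \<le> j" for b
  proof -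
    have zero: "A $ b $ a * B $ (j - b) $ (n + m - j - a) = 0"
      if "a \<le> n + m - j" "a + b \<noteq> n" for a
    proof (cases "a + b < n")
      case False
      then have "(n + m - j - a) + (j - b) < m" using that b j by linarith
      then show ?thesis using B0 by simp
    qed (use A0 in simp)
    show ?thesis
    proof (cases "b \<le> n \<and> j - b \<le> m")
      case True
      then have "(\<Sum>a\<le>n+m-j. A $ b $ a * B $ (j - b) $ (n + m - j - a)) =
          (\<Sum>a\<in>{n - b}. A $ b $ a * B $ (j - b) $ (n + m - j - a))"
        using b j by (intro sum.mono_neutral_right ballI zero) auto
      also have "\<dots> = A $ b $ (n - b) * B $ (j - b) $ (n + m - j - (n - b))"
        by simp
      also have "n + m - j - (n - b) = m - (j - b)"
        using True b j by linarith
      finally show ?thesis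
        by (simp only: True simp_thms if_True)
    next
      case False
      \<comment> \<open>\<open>a + b = n\<close> would give \<open>b \<le> n\<close> and, from
        \<open>a \<le> n + m - j\<close>, also \<open>j - b \<le> m\<close>.\<close>
      then have "a + b \<noteq> n" if "a \<le> n + m - j" for a
        using that b j by linarith
      then have "(\<Sum>a\<le>n+m-j. A $ b $ a * B $ (j - b) $ (n + m - j - a)) = 0"
        by (intro sum.neutral ballI zero) auto
      then show ?thesis by (simp only: False if_False)
    qed
  qed
  have "(A * B) $ j $ (n + m - j) =
      (\<Sum>b\<le>j. \<Sum>a\<le>n+m-j. A $ b $ a * B $ (j - b) $ (n + m - j - a))"
    by (simp add: fps_mult_nth fps_sum_nth atLeast0AtMost)
  also have "\<dots> = (\<Sum>b\<le>j. if b \<le> n \<and> j - b \<le> m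
      then A $ b $ (n - b) * B $ (j - b) $ (m - (j - b)) else 0)"
    by (rule sum.cong) (use inner in auto)
  also have "\<dots> = (\<Sum>b\<in>{b \<in> {..j}. b \<le> n \<and> j - b \<le> m}.
      A $ b $ (n - b) * B $ (j - b) $ (m - (j - b)))"
    by (rule sum.inter_filter[symmetric]) simp
  finally show ?thesis by simp
qed

lemma hom_part_mult:
  assumes "enat n \<le> order2 A" and "enat m \<le> order2 B"
  shows "hom_part (n + m) (A * B) p q = hom_part n A p q * hom_part m B p q"
proof -
  let ?f = "\<lambda>b c. smult (A $ b $ (n - b) * B $ c $ (m - c)) (p ^ (n + m - (b + c)) * q ^ (b + c))"
  let ?I = "\<lambda>j. {b. b \<le> j \<and> b \<le> n \<and> j - b \<le> m}"
  have "hom_part (n + m) (A * B) p q = (\<Sum>j\<le>n+m. \<Sum>b\<in>?I j. ?f b (j - b))"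
    unfolding hom_part_def using assms
    by (intro sum.cong refl) (simp add: nth_mult_lowest smult_sum)
  also have "\<dots> = (\<Sum>(j, b)\<in>(SIGMA j:{..n+m}. ?I j). ?f b (j - b))"
    by (rule sum.Sigma) auto
  \<comment> \<open>With \<open>c = j - b\<close>, the constraints of \<open>?I j\<close> become
    \<open>b \<le> n\<close> and \<open>c \<le> m\<close>.\<close>
  also have "\<dots> = (\<Sum>(b, c)\<in>{..n} \<times> {..m}. ?f b c)"
    by (rule sum.reindex_bij_witness[of _ "\<lambda>(b, c). (b + c, b)" "\<lambda>(j, b). (b, j - b)"]) auto
  also have "\<dots> = (\<Sum>b\<le>n. \<Sum>c\<le>m. ?f b c)"
    by (rule sum.cartesian_product[symmetric])
  also have "\<dots> = (\<Sum>b\<le>n. \<Sum>c\<le>m. smult (A $ b $ (n - b)) (p ^ (n - b) * q ^ b) *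
      smult (B $ c $ (m - c)) (p ^ (m - c) * q ^ c))"
  proof (intro sum.cong refl)
    fix b c assume "b \<in> {..n}" "c \<in> {..m}"
    then have "n + m - (b + c) = (n - b) + (m - c)" by auto
    then show "?f b c = smult (A $ b $ (n - b)) (p ^ (n - b) * q ^ b) *
        smult (B $ c $ (m - c)) (p ^ (m - c) * q ^ c)"
      by (simp add: power_add algebra_simps)
  qed
  also have "\<dots> = hom_part n A p q * hom_part m B p q"
    by (simp add: hom_part_def sum_product)
  finally show ?thesis .
qed

section \<open>Substitution and the charts of the blow-up\<close>

abbreviation poly_x :: "complex poly \<Rightarrow> series2" where
  "poly_x p \<equiv> fps_const (fps_of_poly p)"

text \<open>Since \<open>(y p)^i (y q)^j = y^(i + j) p^i q^j\<close>, the coefficient of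
  \<open>y^n\<close> collects just the terms of total degree \<open>n\<close>, and these all lie
  within the cutoff \<open>i + j \<le> m + n\<close> of \<open>subst2\<close>.\<close>

lemma subst2_vary_mult_nth:
  "subst2 A (vary * poly_x p) (vary * poly_x q) $ n = fps_of_poly (hom_part n A p q)"
proof (rule fps_ext)
  fix m
  have UV: "((vary * poly_x p) ^ i * (vary * poly_x q) ^ j) $ n $ m =
      (if i + j = n then coeff (p ^ i * q ^ j) m else 0)" for i j
  proof -
    have "(vary * poly_x p) ^ i * (vary * poly_x q) ^ j =
        fps_X ^ (i + j) * poly_x (p ^ i * q ^ j)"
      by (simp add: vary_def power_mult_distrib power_add fps_of_poly_mult fps_of_poly_power
          fps_const_power[symmetric] fps_const_mult[symmetric] mult_ac
          del: fps_const_power fps_const_mult)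
    then show ?thesis
      by (simp add: fps_X_power_mult_nth)
  qed
  have fin: "finite {(i, j). i + j \<le> m + n}"
    by (rule finite_subset[of _ "{..m+n} \<times> {..m+n}"]) auto
  have "subst2 A (vary * poly_x p) (vary * poly_x q) $ n $ m =
      (\<Sum>(i, j) \<in> {(i, j). i + j \<le> m + n}.
        A $ j $ i * (if i + j = n then coeff (p ^ i * q ^ j) m else 0))"
    by (simp add: subst2_def UV)
  also have "\<dots> = (\<Sum>(i, j) \<in> {(i, j). i + j = n}. A $ j $ i * coeff (p ^ i * q ^ j) m)"
    using fin by (intro sum.mono_neutral_cong_right) (auto split: if_splits)
  also have "\<dots> = (\<Sum>j\<le>n. A $ j $ (n - j) * coeff (p ^ (n - j) * q ^ j) m)"
    by (rule sum.reindex_bij_witness[of _ "\<lambda>j. (n - j, j)" snd]) auto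
  also have "\<dots> = fps_of_poly (hom_part n A p q) $ m"
    by (simp add: hom_part_def coeff_sum)
  finally show "subst2 A (vary * poly_x p) (vary * poly_x q) $ n $ m =
    fps_of_poly (hom_part n A p q) $ m" .
qed

text \<open>At \<open>x = 0\<close> the pair \<open>(p, q)\<close> spans the line at the centre of
  the chart: \<open>(1, t)\<close> or \<open>(0, 1)\<close>.\<close>

definition blowup_chart :: "complex poly \<Rightarrow> complex poly \<Rightarrow> bool" where
  "blowup_chart p q \<longleftrightarrow> (\<exists>t. p = 1 \<and> q = [:t, 1:]) \<or> p = [:0, 1:] \<and> q = 1"

lemma blowdown_at_chart:
  obtains p q where "blowup_chart p q" "blowdown_at R = (vary * poly_x p, vary * poly_x q)"
proof (cases "\<exists>t. snd R = line (1, t)")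
  case True
  \<comment> \<open>Whichever value \<open>THE\<close> returns, the result is a chart of the first
    kind.\<close>
  define t where "t = (THE t. snd R = line (1, t))"
  have "blowdown_at R = (vary * poly_x 1, vary * poly_x [:t, 1:])"
    using True by (simp add: blowdown_at_def t_def[symmetric] const2_def varx_def fps_of_poly_pCons)
  then show thesis
    using that[of 1 "[:t, 1:]"] by (auto simp: blowup_chart_def)
next
  case False
  then have "blowdown_at R = (vary * poly_x [:0, 1:], vary * poly_x 1)"
    by (simp add: blowdown_at_def varx_def fps_of_poly_pCons)
  then show thesis
    using that[of "[:0, 1:]" 1] by (auto simp: blowup_chart_def)
qed

lemma wronskian_blowup_chart:
  assumes "blowup_chart p q"
  shows "p * pderiv q - pderiv p * q \<noteq> 0"
  using assms by (auto simp: blowup_chart_def pderiv_pCons)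

text \<open>Dehomogenising a form of known degree loses no coefficient, and a chart does just that,
  up to a translation by \<open>t\<close>.\<close>

lemma hom_part_eq_0_imp:
  assumes "blowup_chart p q" and h0: "hom_part n A p q = 0" and j: "j \<le> n"
  shows "A $ j $ (n - j) = 0"
  using assms(1) unfolding blowup_chart_def
proof (elim disjE exE conjE)
  fix t assume pq: "p = 1" "q = [:t, 1:]"
  \<comment> \<open>\<open>P\<close> is the form at \<open>(1, x)\<close>, a translate of
    \<open>hom_part n A p q\<close>.\<close>
  define P where "P = (\<Sum>j\<le>n. monom (A $ j $ (n - j)) j)"
  have "poly P x = poly (hom_part n A p q) (x - t)" for x
    by (simp add: P_def hom_part_def pq poly_sum poly_monom)
  then have "P = 0"
    using h0 by (simp add: poly_all_0_iff_0[symmetric])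
  moreover have "coeff P j = A $ j $ (n - j)"
    using j by (simp add: P_def coeff_sum)
  ultimately show ?thesis by simp
next
  assume pq: "p = [:0, 1:]" "q = 1"
  have "coeff (hom_part n A p q) (n - j) = (\<Sum>i\<le>n. if i = j then A $ i $ (n - i) else 0)"
    unfolding hom_part_def pq coeff_sum
    using j by (intro sum.cong) (auto simp: monom_altdef[of 1, simplified, symmetric])
  then show ?thesis using h0 j by simp
qed

section \<open>Lowest terms of the strict transform\<close>

lemma fol_order_finite:
  assumes "foliation \<omega>"
  shows "fol_order \<omega> \<noteq> \<infinity>"
proof
  assume "fol_order \<omega> = \<infinity>"
  then have "fst \<omega> = 0" "snd \<omega> = 0"
    by (auto simp: fol_order_def min_def order2_eq_infinity_iff split: if_splits)
  moreover have "0 \<in> conv2"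
    by (simp add: conv2_def case_prod_unfold exI[of _ 1])
  \<comment> \<open>\<open>0\<close> is a common divisor of two zero coefficients, so coprimality
    makes it divide \<open>1\<close>.\<close>
  ultimately have "dvd2 0 1"
    using assms unfolding foliation_def coprime2_def dvd2_def by auto
  then show False by (simp add: dvd2_def)
qed

text \<open>The coefficients of \<open>dx\<close> (divided by \<open>y\<close>) and \<open>dy\<close> of the strict transform, restricted to \<open>y = 0\<close>.\<close>

definition lead_dx :: "nat \<Rightarrow> one_form \<Rightarrow> complex poly \<Rightarrow> complex poly \<Rightarrow> complex poly" where
  "lead_dx n \<omega> p q = hom_part n (fst \<omega>) p q * pderiv p + hom_part n (snd \<omega>) p q * pderiv q"

definition lead_dy :: "nat \<Rightarrow> one_form \<Rightarrow> complex poly \<Rightarrow> complex poly \<Rightarrow> complex poly" where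
  "lead_dy n \<omega> p q = hom_part n (fst \<omega>) p q * p + hom_part n (snd \<omega>) p q * q"

text \<open>\<open>d(y p) = y p' dx + p dy\<close>: the extra factor \<open>y\<close> before
  \<open>dx\<close> explains the index \<open>Suc n\<close>.\<close>

lemma pullback_nth:
  fixes p q :: "complex poly" and \<omega> :: one_form
  defines "\<tau> \<equiv> pullback (vary * poly_x p, vary * poly_x q) \<omega>"
  shows "fst \<tau> $ 0 = 0"
    and "fst \<tau> $ Suc n = fps_of_poly (lead_dx n \<omega> p q)"
    and "snd \<tau> $ n = fps_of_poly (lead_dy n \<omega> p q)"
proof -
  have dx: "deriv_x (vary * poly_x r) = vary * poly_x (pderiv r)" for r
    by (rule fps_ext) (auto simp: deriv_x_def vary_def fps_of_poly_pderiv)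
  have dy: "deriv_y (vary * poly_x r) = poly_x r" for r
    by (simp add: deriv_y_def vary_def)
  note \<tau> = \<tau>_def pullback_def Let_def dx dy
  show "fst \<tau> $ 0 = 0"
    by (simp add: \<tau>) (simp add: vary_def)
  show "fst \<tau> $ Suc n = fps_of_poly (lead_dx n \<omega> p q)"
    by (simp add: \<tau> lead_dx_def fps_of_poly_add fps_of_poly_mult subst2_vary_mult_nth[symmetric]
        mult.assoc[symmetric]) (simp add: vary_def)
  show "snd \<tau> $ n = fps_of_poly (lead_dy n \<omega> p q)"
    by (simp add: \<tau> lead_dy_def fps_of_poly_add fps_of_poly_mult subst2_vary_mult_nth)
qed

text \<open>Cramer's rule: both are linear in the homogeneous parts of the coefficients, with
  determinant \<open>p q' - p' q\<close>. If both vanished, so would these parts, but one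
  coefficient has order exactly \<open>n\<close>.\<close>

lemma lead_dx_or_lead_dy_nonzero:
  assumes "blowup_chart p q" and ord: "fol_order \<omega> = enat n"
  shows "lead_dx n \<omega> p q \<noteq> 0 \<or> lead_dy n \<omega> p q \<noteq> 0"
proof (rule ccontr)
  let ?A = "hom_part n (fst \<omega>) p q" and ?B = "hom_part n (snd \<omega>) p q"
  let ?W = "p * pderiv q - pderiv p * q"
  assume "\<not> (lead_dx n \<omega> p q \<noteq> 0 \<or> lead_dy n \<omega> p q \<noteq> 0)"
  then have a: "lead_dx n \<omega> p q = 0" and b: "lead_dy n \<omega> p q = 0" by auto
  have "?A * ?W = lead_dy n \<omega> p q * pderiv q - lead_dx n \<omega> p q * q"
    "?B * ?W = lead_dx n \<omega> p q * p - lead_dy n \<omega> p q * pderiv p"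
    by (simp_all add: lead_dx_def lead_dy_def algebra_simps)
  then have "?A = 0" "?B = 0"
    using a b wronskian_blowup_chart[OF assms(1)] by simp_all
  moreover have "order2 (fst \<omega>) = enat n \<or> order2 (snd \<omega>) = enat n"
    using ord by (auto simp: fol_order_def min_def split: if_splits)
  ultimately show False
    by (metis order2_eq_enatD hom_part_eq_0_imp[OF assms(1)])
qed

text \<open>The vanishing of \<open>lead_dy\<close> is the dicritical case, which invariance
  excludes. Hence exactly \<open>y^n\<close> is divided out.\<close>

lemma strict_transform_lowest:
  assumes chart: "blowup_chart p q" and R: "blowdown_at R = (vary * poly_x p, vary * poly_x q)"
    and ord: "fol_order \<omega> = enat n" and inv: "y0_invariant (strict_transform \<omega> R)"
  shows "lead_dy n \<omega> p q \<noteq> 0"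
    and "fst (strict_transform \<omega> R) $ 1 = fps_of_poly (lead_dx n \<omega> p q)"
    and "snd (strict_transform \<omega> R) $ 0 = fps_of_poly (lead_dy n \<omega> p q)"
proof -
  define \<tau> where "\<tau> = pullback (blowdown_at R) \<omega>"
  define k where "k = (LEAST k. fst \<tau> $ k \<noteq> 0 \<or> snd \<tau> $ k \<noteq> 0)"
  have st: "strict_transform \<omega> R = (fps_shift k (fst \<tau>), fps_shift k (snd \<tau>))"
    by (simp add: strict_transform_def divide_out_y_def \<tau>_def k_def Let_def)
  note \<tau>_nth = pullback_nth[of p q \<omega>, folded R, folded \<tau>_def]
  have less: "lead_dx i \<omega> p q = 0" "lead_dy i \<omega> p q = 0" if "i < n" for i
  proof -
    have "enat i < order2 (fst \<omega>)" "enat i < order2 (snd \<omega>)"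
      using that ord by (metis enat_ord_simps(2) fol_order_def min_less_iff_conj)+
    then show "lead_dx i \<omega> p q = 0" "lead_dy i \<omega> p q = 0"
      by (simp_all add: lead_dx_def lead_dy_def hom_part_eq_0_if_less_order2)
  qed
  have fst0: "fst \<tau> $ i = 0" if "i \<le> n" for i
    using that less(1) \<tau>_nth(1,2) by (cases i) auto
  have snd0: "snd \<tau> $ i = 0" if "i < n" for i
    using that less(2) \<tau>_nth(3) by simp
  show b: "lead_dy n \<omega> p q \<noteq> 0"
  proof
    assume b0: "lead_dy n \<omega> p q = 0"
    then have a: "fst \<tau> $ Suc n \<noteq> 0"
      using lead_dx_or_lead_dy_nonzero[OF chart ord] \<tau>_nth(2) by simp
    \<comment> \<open>In the dicritical case \<open>y^(n + 1)\<close> is divided out, which leaves a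
      \<open>dx\<close> coefficient not divisible by \<open>y\<close>.\<close>
    have "k = Suc n"
      unfolding k_def
    proof (rule Least_equality)
      fix i assume "fst \<tau> $ i \<noteq> 0 \<or> snd \<tau> $ i \<noteq> 0"
      then show "Suc n \<le> i"
        using fst0 snd0 b0 \<tau>_nth(3)
        by (metis fps_of_poly_0 leI less_Suc_eq less_Suc_eq_le)
    qed (use a in simp)
    then have "fst (strict_transform \<omega> R) $ 0 \<noteq> 0"
      using a by (simp add: st)
    then show False
      using inv by (auto simp: y0_invariant_def dvd2_def vary_def)
  qed
  have k: "k = n"
    unfolding k_def
  proof (rule Least_equality)
    fix i assume "fst \<tau> $ i \<noteq> 0 \<or> snd \<tau> $ i \<noteq> 0"
    then show "n \<le> i" using fst0 snd0 by (metis leI less_imp_le)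
  qed (use b \<tau>_nth(3) in simp)
  show "fst (strict_transform \<omega> R) $ 1 = fps_of_poly (lead_dx n \<omega> p q)"
    "snd (strict_transform \<omega> R) $ 0 = fps_of_poly (lead_dy n \<omega> p q)"
    by (simp_all add: st k \<tau>_nth)
qed

section \<open>Residues and the lowest part of the jacobian\<close>

lemma residue_poly_quotient_cong:
  fixes a b a' b' :: "complex poly"
  assumes "b \<noteq> 0" "b' \<noteq> 0" and eq: "a * b' = a' * b"
  shows "residue (\<lambda>x. poly a x / poly b x) z = residue (\<lambda>x. poly a' x / poly b' x) z"
proof (rule residue_cong)
  \<comment> \<open>Finitely many roots leave a punctured neighbourhood of \<open>z\<close> free of
    them, and the residue depends only on values there.\<close>
  have nz: "eventually (\<lambda>x. poly r x \<noteq> 0) (at z)" if "r \<noteq> 0" for r :: "complex poly"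
    using islimpt_finite[OF poly_roots_finite[OF that], of z]
    by (simp add: islimpt_iff_eventually)
  show "eventually (\<lambda>x. poly a x / poly b x = poly a' x / poly b' x) (at z)"
    using nz[OF assms(1)] nz[OF assms(2)]
  proof eventually_elim
    case (elim x)
    then show ?case
      using arg_cong[OF eq, of "\<lambda>r. poly r x"] by (simp add: field_simps)
  qed
qed simp

text \<open>Multiplicativity of determinants: one linear map, of determinant
  \<open>p q' - p' q\<close>, sends the homogeneous parts of either form to its pair
  \<open>lead_dy\<close>, \<open>lead_dx\<close>.\<close>

lemma jacobian_lowest:
  assumes "enat n \<le> fol_order \<omega>" and "enat m \<le> fol_order \<eta>"
  shows "lead_dy n \<omega> p q * lead_dx m \<eta> p q - lead_dx n \<omega> p q * lead_dy m \<eta> p q =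
    hom_part (n + m) (jacobian_curve \<omega> \<eta>) p q * (p * pderiv q - pderiv p * q)"
proof -
  have "hom_part (n + m) (jacobian_curve \<omega> \<eta>) p q =
      hom_part n (fst \<omega>) p q * hom_part m (snd \<eta>) p q -
      hom_part n (snd \<omega>) p q * hom_part m (fst \<eta>) p q"
    using assms by (simp add: fol_order_def jacobian_curve_def hom_part_diff hom_part_mult)
  then show ?thesis
    unfolding lead_dx_def lead_dy_def by (simp only:) (simp add: algebra_simps)
qed

lemma order2_jacobian_ge:
  assumes "enat n \<le> fol_order \<omega>" and "enat m \<le> fol_order \<eta>"
  shows "enat (n + m) \<le> order2 (jacobian_curve \<omega> \<eta>)"
proof -
  have mult: "(A * B) $ j $ i = 0"
    if "enat n \<le> order2 A" "enat m \<le> order2 B" "i + j < n + m" for A B i j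
  proof -
    have "A $ b $ a * B $ (j - b) $ (i - a) = 0" if "a \<le> i" "b \<le> j" for a b
    proof (cases "a + b < n")
      case False
      then have "(i - a) + (j - b) < m"
        using that \<open>i + j < n + m\<close> by linarith
      then show ?thesis
        using \<open>enat m \<le> order2 B\<close> by (simp add: enat_le_order2_iff)
    qed (use \<open>enat n \<le> order2 A\<close> in \<open>simp add: enat_le_order2_iff\<close>)
    then show ?thesis
      by (simp add: fps_mult_nth fps_sum_nth sum.neutral)
  qed
  show ?thesis
    using assms unfolding enat_le_order2_iff[of "n + m"] jacobian_curve_def fol_order_def
    by (simp add: mult)
qed

theorem lemma2p3:
  fixes \<omega> \<eta> :: one_form
  assumes "foliation \<omega>" and "foliation \<eta>"
    and "exc_invariant \<omega>" and "exc_invariant \<eta>"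
    and "\<exists>R\<in>exc_divisor. exc_index \<omega> R \<noteq> exc_index \<eta> R"
  shows "order2 (jacobian_curve \<omega> \<eta>) = fol_order \<omega> + fol_order \<eta>"
proof -
  obtain n m where n: "fol_order \<omega> = enat n" and m: "fol_order \<eta> = enat m"
    using fol_order_finite assms(1,2) by (metis not_infinity_eq)
  obtain R where R: "R \<in> exc_divisor" and ne: "exc_index \<omega> R \<noteq> exc_index \<eta> R"
    using assms(5) by blast
  obtain p q where chart: "blowup_chart p q"
    and pq: "blowdown_at R = (vary * poly_x p, vary * poly_x q)"
    by (rule blowdown_at_chart)
  have inv: "y0_invariant (strict_transform \<omega> R)" "y0_invariant (strict_transform \<eta> R)"
    using R assms(3,4) by (auto simp: exc_invariant_def)
  note low\<omega> = strict_transform_lowest[OF chart pq n inv(1)]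
  note low\<eta> = strict_transform_lowest[OF chart pq m inv(2)]
  have "enat (n + m) \<le> order2 (jacobian_curve \<omega> \<eta>)"
    using n m by (intro order2_jacobian_ge) auto
  moreover have "\<not> enat (n + m) < order2 (jacobian_curve \<omega> \<eta>)"
  proof
    assume "enat (n + m) < order2 (jacobian_curve \<omega> \<eta>)"
    then have "lead_dx n \<omega> p q * lead_dy m \<eta> p q = lead_dx m \<eta> p q * lead_dy n \<omega> p q"
      using jacobian_lowest[of n \<omega> m \<eta> p q] n m
      by (simp add: hom_part_eq_0_if_less_order2 mult.commute)
    from residue_poly_quotient_cong[OF low\<omega>(1) low\<eta>(1) this, of 0]
    \<comment> \<open>The \<open>fps_shift 1\<close> in \<open>camacho_sad\<close> selects the
      \<open>dx\<close> coefficient at index \<open>1\<close>; on \<open>y = 0\<close> both series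
      are polynomials, so \<open>eval_fps\<close> becomes \<open>poly\<close>.\<close>
    have "exc_index \<omega> R = exc_index \<eta> R"
      using low\<omega>(2,3) low\<eta>(2,3) by (simp add: exc_index_def camacho_sad_def Let_def)
    with ne show False by simp
  qed
  ultimately show ?thesis using n m by (simp add: order_le_less)
qed

end
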